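(* Let $\Bbbk$ be a field, let $n = 2k$ with $k \ge 4$, and let $R = \Bbbk[x_1,\dots,x_n]$. Define the following sets of squarefree monomials: - $G_1 = \{x_{2i}x_{2j} \mid 1 \le i < j < k\}$; - $\mathrm{NF} = \{x_i x_j \mid i \ge 1 \text{ odd},\ j \text{ even},\ i+1 < j < 2k\}$; - $G_2 = \{x_i x_j x_{2k-1} \mid 1 \le i < j < 2k-1,\ x_i x_j \notin \mathrm{NF} \cup G_1\}$; - $G_3 = \{x_i x_j x_l \mid 1 \le i < j < l < 2k-1,\ i,j,l \text{ odd}\}$; - $G_4 = \{x_{2k} x_i x_j \mid 1 \le i < j \le 2k-1,\ i,j \text{ odd}\}$; - $G_5 = \{x_{2k} x_{2k-1} x_i \mid i \text{ even},\ 2 \le i \le 2k-2\}$; - $G_6$: any set of exactly $$\frac{k^3-3k^2-4k+6}{6}$$ squarefree monomials of degree 3 in $R$, none belonging to $G_2 \cup G_3 \cup G_4 \cup G_5$ and none divisible by a monomial of $G_1 \cup \mathrm{NF}$. Then the ideal $I = \langle G_1 \cup G_2 \cup G_3 \cup G_4 \cup G_5 \cup G_6\rangle$ is an $f$-ideal.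
   Context: Let $I \subseteq \Bbbk[x_1,\dots,x_n]$ be a squarefree monomial ideal whose minimal monomial generators all have degree at least 2. Identify a subset $F \subseteq \{x_1,\dots,x_n\}$ with the squarefree monomial $x_F = \prod_{x_i \in F} x_i$. The Stanley-Reisner complex $\Delta_I$ is the simplicial complex whose faces are the sets $F$ with $x_F \notin I$. The facet complex $\Delta(I)$ is the simplicial complex whose facets are the sets $F$ such that $x_F$ is a minimal generator of $I$; that is, its faces are the sets $F$ such that $x_F$ divides some minimal generator of $I$. The $f$-vector of a simplicial complex of dimension $e$ is $(f_{-1},f_0,\dots,f_e)$, where $f_i$ is the number of faces with $i+1$ elements ($f_{-1}=1$ for a nonempty complex). The ideal $I$ is called an $f$-ideal if $\Delta_I$ and $\Delta(I)$ have the same $f$-vector. *)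

theory Defs
  imports Complex_Main "HOL-Algebra.Ideal" "HOL-Algebra.Divisibility" "HOL-Library.Poly_Mapping"
begin

section \<open>The polynomial ring in finitely many variables\<close>

text \<open>
  A monomial \<open>x\<^sub>1\<^bsup>a\<^sub>1\<^esup> \<dots> x\<^sub>n\<^bsup>a\<^sub>n\<^esup>\<close> is given by its exponent vector
  \<open>a :: nat \<Rightarrow>\<^sub>0 nat\<close>, and a polynomial maps exponent vectors to coefficients. The type
  itself has a variable \<open>x\<^sub>i\<close> for every natural number \<open>i\<close>; the ring in \<open>x\<^sub>1, \<dots>, x\<^sub>n\<close> is
  the subring \<open>pring n\<close>.
\<close>

type_synonym 'a mpol = "(nat \<Rightarrow>\<^sub>0 nat) \<Rightarrow>\<^sub>0 'a"

definition pring :: "nat \<Rightarrow> 'a::comm_ring_1 mpol ring" where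
  "pring n =
     \<lparr>carrier = {p. \<forall>a \<in> Poly_Mapping.keys p. Poly_Mapping.keys a \<subseteq> {1..n}},
      monoid.mult = (*), one = 1, zero = 0, add = (+)\<rparr>"

definition mon :: "(nat \<Rightarrow>\<^sub>0 nat) \<Rightarrow> 'a::comm_ring_1 mpol" where
  "mon a = Poly_Mapping.single a 1"

definition mdeg :: "(nat \<Rightarrow>\<^sub>0 nat) \<Rightarrow> nat" where
  "mdeg a = (\<Sum>i \<in> Poly_Mapping.keys a. Poly_Mapping.lookup a i)"

definition monomials :: "nat \<Rightarrow> 'a::comm_ring_1 mpol set" where
  "monomials n = {mon a | a. Poly_Mapping.keys a \<subseteq> {1..n}}"

definition X :: "nat \<Rightarrow> 'a::comm_ring_1 mpol" where
  "X i = mon (Poly_Mapping.single i 1)"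

definition xset :: "nat set \<Rightarrow> 'a::comm_ring_1 mpol" where
  "xset F = (\<Prod>i \<in> F. X i)"

definition sqfree_monomials :: "nat \<Rightarrow> 'a::comm_ring_1 mpol set" where
  "sqfree_monomials n = {xset F | F. F \<subseteq> {1..n}}"

definition sqfree_monomials_deg :: "nat \<Rightarrow> nat \<Rightarrow> 'a::comm_ring_1 mpol set" where
  "sqfree_monomials_deg n d = {xset F | F. F \<subseteq> {1..n} \<and> card F = d}"

lemma cring_pring: "cring (pring n :: 'a::comm_ring_1 mpol ring)"
proof (rule cringI)
  show "abelian_group (pring n :: 'a mpol ring)"
  proof (rule abelian_groupI)
    fix p q :: "'a mpol"
    assume "p \<in> carrier (pring n)" "q \<in> carrier (pring n)"
    then show "p \<oplus>\<^bsub>pring n\<^esub> q \<in> carrier (pring n)"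
      using Poly_Mapping.keys_add[of p q] by (auto simp: pring_def)
  next
    fix p :: "'a mpol"
    assume "p \<in> carrier (pring n)"
    then show "\<exists>q \<in> carrier (pring n). q \<oplus>\<^bsub>pring n\<^esub> p = \<zero>\<^bsub>pring n\<^esub>"
      by (intro bexI[of _ "- p"]) (auto simp: pring_def)
  qed (auto simp: pring_def algebra_simps)
  show "comm_monoid (pring n :: 'a mpol ring)"
  proof (rule comm_monoidI)
    fix p q :: "'a mpol"
    assume p: "p \<in> carrier (pring n)" and q: "q \<in> carrier (pring n)"
    have "Poly_Mapping.keys c \<subseteq> {1..n}" if "c \<in> Poly_Mapping.keys (p * q)" for c
    proof -
      from that obtain a b where ab: "c = a + b" "a \<in> Poly_Mapping.keys p" "b \<in> Poly_Mapping.keys q"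
        using keys_mult[of p q] by blast
      then show ?thesis
        using p q Poly_Mapping.keys_add[of a b] unfolding pring_def by fastforce
    qed
    then show "p \<otimes>\<^bsub>pring n\<^esub> q \<in> carrier (pring n)"
      by (auto simp: pring_def)
  qed (auto simp: pring_def algebra_simps)
qed (auto simp: pring_def algebra_simps)


section \<open>Monomial ideals and \<open>f\<close>-ideals\<close>

definition sqfree_monomial_ideal :: "nat \<Rightarrow> 'a::comm_ring_1 mpol set \<Rightarrow> bool" where
  "sqfree_monomial_ideal n I \<longleftrightarrow>
     (\<exists>M. M \<subseteq> sqfree_monomials n \<and> I = Idl\<^bsub>pring n\<^esub> M)"

definition min_monomial_gen_set ::
  "nat \<Rightarrow> 'a::comm_ring_1 mpol set \<Rightarrow> 'a mpol set \<Rightarrow> bool" where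
  "min_monomial_gen_set n I M \<longleftrightarrow>
     M \<subseteq> monomials n \<and> Idl\<^bsub>pring n\<^esub> M = I \<and> (\<forall>M'. M' \<subset> M \<longrightarrow> Idl\<^bsub>pring n\<^esub> M' \<noteq> I)"

text \<open>
  A monomial ideal has exactly one minimal monomial generating set, so the union below is
  that set.
\<close>

definition min_gens :: "nat \<Rightarrow> 'a::comm_ring_1 mpol set \<Rightarrow> 'a mpol set" where
  "min_gens n I = \<Union>{M. min_monomial_gen_set n I M}"

text \<open>Vertices are variable indices: the face \<open>F \<subseteq> {1..n}\<close> stands for \<open>{x\<^sub>i | i \<in> F}\<close>.\<close>

definition stanley_reisner_complex :: "nat \<Rightarrow> 'a::comm_ring_1 mpol set \<Rightarrow> nat set set" where
  "stanley_reisner_complex n I = {F. F \<subseteq> {1..n} \<and> xset F \<notin> I}"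

definition facet_complex :: "nat \<Rightarrow> 'a::comm_ring_1 mpol set \<Rightarrow> nat set set" where
  "facet_complex n I =
     {F. F \<subseteq> {1..n} \<and> (\<exists>m \<in> min_gens n I. xset F divides\<^bsub>pring n\<^esub> m)}"

definition complex_dim :: "nat set set \<Rightarrow> int" where
  "complex_dim \<Delta> = Max ((\<lambda>F. int (card F) - 1) ` \<Delta>)"

definition face_count :: "nat set set \<Rightarrow> int \<Rightarrow> nat" where
  "face_count \<Delta> i = card {F \<in> \<Delta>. int (card F) = i + 1}"

text \<open>
  The list \<open>(f\<^sub>-\<^sub>1, f\<^sub>0, \<dots>, f\<^sub>e)\<close>, whose length records the dimension \<open>e\<close>. The complex with
  no faces at all gets the empty list, as \<open>complex_dim\<close> is unspecified there.
\<close>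

definition f_vector :: "nat set set \<Rightarrow> nat list" where
  "f_vector \<Delta> = (if \<Delta> = {} then [] else map (face_count \<Delta>) [-1..complex_dim \<Delta>])"

definition f_ideal :: "nat \<Rightarrow> 'a::field mpol set \<Rightarrow> bool" where
  "f_ideal n I \<longleftrightarrow>
     sqfree_monomial_ideal n I \<and>
     (\<forall>a. mon a \<in> min_gens n I \<longrightarrow> 2 \<le> mdeg a) \<and>
     f_vector (stanley_reisner_complex n I) = f_vector (facet_complex n I)"


section \<open>The sets of generators\<close>

definition G1 :: "nat \<Rightarrow> 'a::field mpol set" where
  "G1 k = {X (2 * i) * X (2 * j) | i j. 1 \<le> i \<and> i < j \<and> j < k}"

definition NF :: "nat \<Rightarrow> 'a::field mpol set" where
  "NF k = {X i * X j | i j. 1 \<le> i \<and> odd i \<and> even j \<and> i + 1 < j \<and> j < 2 * k}"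

definition G2 :: "nat \<Rightarrow> 'a::field mpol set" where
  "G2 k = {X i * X j * X (2 * k - 1) | i j.
             1 \<le> i \<and> i < j \<and> j < 2 * k - 1 \<and> (X i * X j :: 'a mpol) \<notin> NF k \<union> G1 k}"

definition G3 :: "nat \<Rightarrow> 'a::field mpol set" where
  "G3 k = {X i * X j * X l | i j l.
             1 \<le> i \<and> i < j \<and> j < l \<and> l < 2 * k - 1 \<and> odd i \<and> odd j \<and> odd l}"

definition G4 :: "nat \<Rightarrow> 'a::field mpol set" where
  "G4 k = {X (2 * k) * X i * X j | i j.
             1 \<le> i \<and> i < j \<and> j \<le> 2 * k - 1 \<and> odd i \<and> odd j}"

definition G5 :: "nat \<Rightarrow> 'a::field mpol set" where
  "G5 k = {X (2 * k) * X (2 * k - 1) * X i | i. even i \<and> 2 \<le> i \<and> i \<le> 2 * k - 2}"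

end

theory Submission
  imports Defs "HOL-Library.Ramsey"
begin

text \<open>
  Squarefree monomials divide each other exactly when their index sets are contained in each
  other, and a monomial lies in a monomial ideal exactly when a generator divides it. So for an
  antichain \<open>\<G>\<close> of index sets, the faces of the Stanley-Reisner complex are the sets that
  contain no member of \<open>\<G>\<close>, and the faces of the facet complex are the subsets of members of
  \<open>\<G>\<close> (\<open>f_ideal_xsetI\<close>). Being an \<open>f\<close>-ideal is then a counting statement about \<open>\<G>\<close>.

  Here \<open>\<G>\<close> consists of a set \<open>E\<close> of pairs (the \<^emph>\<open>edges\<close>, from \<open>G1\<close>) and a set \<open>T\<close> of triples
  (from \<open>G2\<close> to \<open>G6\<close>). Comparing faces of each cardinality leaves three things to show
  (\<open>f_ideal_pairs_triplesI\<close>), besides the absence of edges inside triples and the covering of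
  all vertices:

  \<^item> As many pairs are edges as are covered by no generator. The uncovered pairs turn out to be
    exactly the \<^emph>\<open>gaps\<close>, from \<open>NF\<close> (\<open>uncovered_pairs_eq_gaps\<close>), and a shift by one puts gaps
    and edges in bijection (\<open>card_gaps\<close>).

  \<^item> Precisely half of the edge-free triples are in \<open>T\<close>. Edge-free triples
    (\<open>real_card_triples_without_edge\<close>) and the triples from \<open>G2\<close> to \<open>G5\<close>
    (\<open>card_fixed_triples\<close>) are counted by binomial coefficients, and the size prescribed for
    \<open>G6\<close> is what is missing to one half.

  \<^item> Every set of four indices contains a generator. This is the pigeonhole principle applied to
    the parities of the indices (\<open>quads_contain_generator\<close>).
\<close>

section \<open>Monomial ideals and divisibility\<close>

lemma mon_add: "mon (a + b) = (mon a * mon b :: 'a::comm_ring_1 mpol)"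
  by (simp add: mon_def mult_single)

lemma keys_mon [simp]: "Poly_Mapping.keys (mon a :: 'a::comm_ring_1 mpol) = {a}"
  by (simp add: mon_def)

lemma mon_eq_iff [simp]: "(mon a :: 'a::comm_ring_1 mpol) = mon b \<longleftrightarrow> a = b"
  by (metis keys_mon singleton_inject)

lemma keys_add_nat:
  fixes a b :: "nat \<Rightarrow>\<^sub>0 nat"
  shows "Poly_Mapping.keys (a + b) = Poly_Mapping.keys a \<union> Poly_Mapping.keys b"
  by (auto simp: in_keys_iff lookup_add)

lemma mon_in_carrier_iff:
  "(mon a :: 'a::comm_ring_1 mpol) \<in> carrier (pring n) \<longleftrightarrow> Poly_Mapping.keys a \<subseteq> {1..n}"
  by (simp add: pring_def)

lemma pring_mult: "p \<otimes>\<^bsub>pring n\<^esub> q = p * q"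
  and pring_add: "p \<oplus>\<^bsub>pring n\<^esub> q = p + q"
  and pring_zero: "\<zero>\<^bsub>pring n\<^esub> = 0"
  by (simp_all add: pring_def)

lemma pring_ring: "ring (pring n :: 'a::comm_ring_1 mpol ring)"
  using cring_pring cring_def by blast

lemma pring_a_inv:
  fixes p :: "'a::comm_ring_1 mpol"
  assumes "p \<in> carrier (pring n)"
  shows "\<ominus>\<^bsub>pring n\<^esub> p = - p"
proof -
  interpret ring "pring n :: 'a mpol ring" by (rule pring_ring)
  have "p + \<ominus>\<^bsub>pring n\<^esub> p = 0"
    using r_neg[OF assms] by (simp add: pring_add pring_zero)
  then show ?thesis by (metis add_eq_0_iff)
qed

text \<open>
  The set in question is the candidate for the monomial ideal generated by the exponent
  vectors in \<open>A\<close>. It is described coefficientwise, so that membership of a single monomial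
  can be read off without knowing a representation as a linear combination.
\<close>

lemma ideal_monomial_multiples:
  fixes A :: "(nat \<Rightarrow>\<^sub>0 nat) set"
  shows "ideal {p \<in> carrier (pring n). \<forall>c \<in> Poly_Mapping.keys p. \<exists>a \<in> A. \<exists>b. c = a + b}
           (pring n :: 'a::comm_ring_1 mpol ring)" (is "ideal ?J ?R")
proof -
  interpret ring ?R by (rule pring_ring)
  have closed: "x * a \<in> ?J" if "a \<in> ?J" "x \<in> carrier ?R" for a x :: "'a mpol"
  proof -
    have "x * a \<in> carrier ?R"
      using that m_closed[of x a] by (simp add: pring_mult)
    moreover have "\<exists>d \<in> A. \<exists>b. c = d + b" if c: "c \<in> Poly_Mapping.keys (x * a)" for c
    proof -
      obtain u v where "c = u + v" "v \<in> Poly_Mapping.keys a"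
        using keys_mult[of x a] c by blast
      moreover obtain d b where "d \<in> A" "v = d + b"
        using \<open>a \<in> ?J\<close> calculation(2) by blast
      ultimately have "c = d + (u + b)" by (simp add: ac_simps)
      then show ?thesis using \<open>d \<in> A\<close> by blast
    qed
    ultimately show ?thesis by blast
  qed
  show ?thesis
  proof (rule idealI)
    show "subgroup ?J (add_monoid ?R)"
    proof (rule subgroup.intro)
      fix x y assume "x \<in> ?J" "y \<in> ?J"
      then show "x \<otimes>\<^bsub>add_monoid ?R\<^esub> y \<in> ?J"
        using Poly_Mapping.keys_add[of x y] a_closed[of x y] by (auto simp: pring_add)
    next
      fix x assume "x \<in> ?J"
      moreover from this have "inv\<^bsub>add_monoid ?R\<^esub> x = - x"
        using pring_a_inv[of x n] by (simp add: a_inv_def)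
      moreover have "- x \<in> carrier ?R"
        using \<open>x \<in> ?J\<close> by (auto simp: pring_def)
      ultimately show "inv\<^bsub>add_monoid ?R\<^esub> x \<in> ?J" by simp
    qed (use zero_closed in \<open>auto simp: pring_zero\<close>)
  next
    fix a x assume "a \<in> ?J" "x \<in> carrier ?R"
    from closed[OF this] show "x \<otimes>\<^bsub>?R\<^esub> a \<in> ?J" "a \<otimes>\<^bsub>?R\<^esub> x \<in> ?J"
      by (simp_all only: pring_mult mult.commute[of a x])
  qed (rule pring_ring)
qed

lemma mon_in_Idl_iff:
  assumes A: "\<forall>a \<in> A. Poly_Mapping.keys a \<subseteq> {1..n}" and c: "Poly_Mapping.keys c \<subseteq> {1..n}"
  shows "(mon c :: 'a::comm_ring_1 mpol) \<in> Idl\<^bsub>pring n\<^esub> (mon ` A) \<longleftrightarrow> (\<exists>a \<in> A. \<exists>b. c = a + b)"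
proof -
  let ?R = "pring n :: 'a mpol ring"
  interpret ring ?R by (rule pring_ring)
  have sub: "mon ` A \<subseteq> carrier ?R"
    using A by (auto simp: mon_in_carrier_iff)
  show ?thesis
  proof
    let ?J = "{p \<in> carrier ?R. \<forall>c \<in> Poly_Mapping.keys p. \<exists>a \<in> A. \<exists>b. c = a + b}"
    have "mon ` A \<subseteq> ?J"
    proof clarsimp
      fix a assume "a \<in> A"
      moreover have "a = a + 0" by simp
      ultimately show "mon a \<in> carrier ?R \<and> (\<exists>d \<in> A. \<exists>b. a = d + b)"
        using sub by blast
    qed
    then have "Idl\<^bsub>?R\<^esub> (mon ` A) \<subseteq> ?J"
      by (rule genideal_minimal[OF ideal_monomial_multiples])
    moreover assume "mon c \<in> Idl\<^bsub>?R\<^esub> (mon ` A)"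
    ultimately have "(mon c :: 'a mpol) \<in> ?J" by blast
    then show "\<exists>a \<in> A. \<exists>b. c = a + b" by simp
  next
    assume "\<exists>a \<in> A. \<exists>b. c = a + b"
    then obtain a b where ab: "a \<in> A" "c = a + b" by blast
    have "(mon a :: 'a mpol) \<in> Idl\<^bsub>?R\<^esub> (mon ` A)"
      using genideal_self[OF sub] ab by blast
    moreover have "(mon b :: 'a mpol) \<in> carrier ?R"
      using c ab by (simp add: mon_in_carrier_iff keys_add_nat)
    ultimately show "(mon c :: 'a mpol) \<in> Idl\<^bsub>?R\<^esub> (mon ` A)"
      using ideal.I_r_closed[OF genideal_ideal[OF sub]] ab by (simp add: mon_add pring_mult)
  qed
qed

lemma mon_divides_iff:
  assumes "Poly_Mapping.keys c \<subseteq> {1..n}"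
  shows "(mon a :: 'a::comm_ring_1 mpol) divides\<^bsub>pring n\<^esub> mon c \<longleftrightarrow> (\<exists>b. c = a + b)"
proof
  assume "(mon a :: 'a mpol) divides\<^bsub>pring n\<^esub> mon c"
  then obtain q :: "'a mpol" where "mon c = mon a * q"
    by (auto simp: factor_def pring_mult)
  then have "c \<in> Poly_Mapping.keys (mon a * q)"
    by (metis insertI1 keys_mon)
  then show "\<exists>b. c = a + b"
    using keys_mult[of "mon a :: 'a mpol" q] by auto
next
  assume "\<exists>b. c = a + b"
  then obtain b where b: "c = a + b" by blast
  then have "(mon b :: 'a mpol) \<in> carrier (pring n)"
    using assms by (simp add: mon_in_carrier_iff keys_add_nat)
  then show "(mon a :: 'a mpol) divides\<^bsub>pring n\<^esub> mon c"
    by (auto simp: factor_def pring_mult b mon_add)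
qed

text \<open>
  Let \<open>B\<close> generate the same ideal as the antichain \<open>A\<close>. Each \<open>a \<in> A\<close> is a multiple of some
  \<open>b \<in> B\<close>, which in turn is a multiple of some \<open>a' \<in> A\<close>. Since \<open>A\<close> is an antichain,
  \<open>a' = a\<close>, and hence \<open>b = a\<close>. So \<open>A\<close> is contained in every monomial generating set: it is
  the only minimal one.
\<close>

lemma min_gens_antichain:
  assumes A: "\<forall>a \<in> A. Poly_Mapping.keys a \<subseteq> {1..n}"
    and antichain: "\<And>a b. a \<in> A \<Longrightarrow> a + b \<in> A \<Longrightarrow> b = 0"
  shows "min_gens n (Idl\<^bsub>pring n\<^esub> (mon ` A)) = (mon ` A :: 'a::comm_ring_1 mpol set)"
proof -
  let ?I = "Idl\<^bsub>pring n\<^esub> (mon ` A) :: 'a mpol set"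
  have gens_contain: "A \<subseteq> B"
    if B: "\<forall>b \<in> B. Poly_Mapping.keys b \<subseteq> {1..n}" and eq: "Idl\<^bsub>pring n\<^esub> (mon ` B) = ?I" for B
  proof
    fix a assume a: "a \<in> A"
    have trivial: "\<exists>d \<in> S. \<exists>e. c = d + e" if "c \<in> S" for c :: "nat \<Rightarrow>\<^sub>0 nat" and S
      using that by (metis add.right_neutral)
    have "mon a \<in> ?I"
      using mon_in_Idl_iff[OF A bspec[OF A a], where 'a = 'a] trivial[OF a] by simp
    then obtain b u where b: "b \<in> B" "a = b + u"
      using mon_in_Idl_iff[OF B bspec[OF A a], where 'a = 'a] unfolding eq by blast
    have "mon b \<in> ?I"
      unfolding eq[symmetric]
      using mon_in_Idl_iff[OF B bspec[OF B b(1)], where 'a = 'a] trivial[OF b(1)] by simp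
    then obtain a' v where a': "a' \<in> A" "b = a' + v"
      using mon_in_Idl_iff[OF A bspec[OF B b(1)], where 'a = 'a] by blast
    have "v + u = 0"
      using antichain[of a' "v + u"] a b a' by (simp add: add.assoc)
    then have "Poly_Mapping.keys v \<union> Poly_Mapping.keys u = {}"
      using keys_add_nat[of v u] by simp
    then show "a \<in> B" using b by simp
  qed
  have contain: "mon ` A \<subseteq> M" if M: "M \<subseteq> monomials n" "Idl\<^bsub>pring n\<^esub> M = ?I" for M
  proof -
    obtain B where "M = mon ` B" "\<forall>b \<in> B. Poly_Mapping.keys b \<subseteq> {1..n}"
    proof
      show "M = mon ` {b. Poly_Mapping.keys b \<subseteq> {1..n} \<and> mon b \<in> M}"
        using M(1) by (auto simp: monomials_def)
    qed auto
    then show ?thesis using gens_contain M(2) by blast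
  qed
  have sub: "mon ` A \<subseteq> (monomials n :: 'a mpol set)"
    using A by (auto simp: monomials_def)
  have "min_monomial_gen_set n ?I M \<longleftrightarrow> M = mon ` A" for M
  proof
    assume "min_monomial_gen_set n ?I M"
    then have "M \<subseteq> monomials n" "Idl\<^bsub>pring n\<^esub> M = ?I" "\<not> mon ` A \<subset> M"
      by (auto simp: min_monomial_gen_set_def)
    then show "M = mon ` A" using contain by blast
  next
    assume "M = mon ` A"
    moreover have "Idl\<^bsub>pring n\<^esub> M' \<noteq> ?I" if "M' \<subset> mon ` A" for M'
      using contain[of M'] that sub by blast
    ultimately show "min_monomial_gen_set n ?I M"
      using sub by (simp add: min_monomial_gen_set_def)
  qed
  then show ?thesis by (simp add: min_gens_def)
qed

section \<open>Squarefree monomial ideals as set systems\<close>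

definition expo :: "nat set \<Rightarrow> (nat \<Rightarrow>\<^sub>0 nat)" where
  "expo F = (\<Sum>i \<in> F. Poly_Mapping.single i 1)"

lemma lookup_expo: "finite F \<Longrightarrow> Poly_Mapping.lookup (expo F) i = (if i \<in> F then 1 else 0)"
  by (simp add: expo_def lookup_sum lookup_single when_def)

lemma keys_expo: "finite F \<Longrightarrow> Poly_Mapping.keys (expo F) = F"
  by (auto simp: in_keys_iff lookup_expo split: if_splits)

lemma mdeg_expo: "finite F \<Longrightarrow> mdeg (expo F) = card F"
  by (simp add: mdeg_def keys_expo lookup_expo)

lemma xset_eq_mon: "finite F \<Longrightarrow> xset F = (mon (expo F) :: 'a::comm_ring_1 mpol)"
proof (induction F rule: finite_induct)
  case empty
  then show ?case by (simp add: xset_def expo_def mon_def)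
next
  case (insert i F)
  then show ?case by (simp add: xset_def expo_def X_def mon_add)
qed

lemma expo_divides_iff:
  assumes "finite F" "finite G"
  shows "(\<exists>b. expo G = expo F + b) \<longleftrightarrow> F \<subseteq> G"
proof
  assume "\<exists>b. expo G = expo F + b"
  then obtain b where "expo G = expo F + b" by blast
  then have "Poly_Mapping.keys (expo F) \<subseteq> Poly_Mapping.keys (expo G)"
    by (simp add: keys_add_nat)
  then show "F \<subseteq> G" using assms by (simp add: keys_expo)
next
  assume "F \<subseteq> G"
  then have "expo G = expo F + expo (G - F)"
    using assms by (metis add.commute expo_def sum.subset_diff)
  then show "\<exists>b. expo G = expo F + b" by blast
qed

lemma xset_eq_iff:
  assumes "finite F" "finite G"
  shows "(xset F :: 'a::comm_ring_1 mpol) = xset G \<longleftrightarrow> F = G"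
  using assms by (metis keys_expo mon_eq_iff xset_eq_mon)

lemma xset_divides_iff:
  assumes "F \<subseteq> {1..n}" "G \<subseteq> {1..n}"
  shows "(xset F :: 'a::comm_ring_1 mpol) divides\<^bsub>pring n\<^esub> xset G \<longleftrightarrow> F \<subseteq> G"
proof -
  have "finite F" "finite G" using assms finite_subset by blast+
  then show ?thesis
    using assms by (simp add: xset_eq_mon keys_expo mon_divides_iff expo_divides_iff)
qed

context
  fixes n :: nat and \<G> :: "nat set set"
  assumes sub: "\<And>F. F \<in> \<G> \<Longrightarrow> F \<subseteq> {1..n}"
begin

lemma finite_gen: "F \<in> \<G> \<Longrightarrow> finite F"
  using sub finite_subset by blast

lemma keys_gen: "\<forall>a \<in> expo ` \<G>. Poly_Mapping.keys a \<subseteq> {1..n}"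
proof clarsimp
  fix F i assume "F \<in> \<G>" "i \<in> Poly_Mapping.keys (expo F)"
  then show "Suc 0 \<le> i \<and> i \<le> n"
    using sub[of F] by (auto simp: keys_expo finite_gen)
qed

lemma xset_image: "xset ` \<G> = (mon ` expo ` \<G> :: 'a::comm_ring_1 mpol set)"
  unfolding image_image by (rule image_cong) (auto simp: xset_eq_mon finite_gen)

lemma xset_in_Idl_iff:
  assumes "F \<subseteq> {1..n}"
  shows "(xset F :: 'a::comm_ring_1 mpol) \<in> Idl\<^bsub>pring n\<^esub> (xset ` \<G>) \<longleftrightarrow> (\<exists>G \<in> \<G>. G \<subseteq> F)"
proof -
  have "finite F" using assms finite_subset by blast
  then have "(xset F :: 'a mpol) \<in> Idl\<^bsub>pring n\<^esub> (xset ` \<G>) \<longleftrightarrow>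
      (\<exists>G \<in> \<G>. \<exists>b. expo F = expo G + b)"
    unfolding xset_image xset_eq_mon[OF \<open>finite F\<close>]
    by (subst mon_in_Idl_iff[OF keys_gen]) (use assms \<open>finite F\<close> in \<open>simp_all add: keys_expo\<close>)
  also have "\<dots> \<longleftrightarrow> (\<exists>G \<in> \<G>. G \<subseteq> F)"
    by (intro bex_cong refl expo_divides_iff finite_gen \<open>finite F\<close>)
  finally show ?thesis .
qed

lemma min_gens_xset:
  assumes antichain: "\<And>F G. F \<in> \<G> \<Longrightarrow> G \<in> \<G> \<Longrightarrow> F \<subseteq> G \<Longrightarrow> F = G"
  shows "min_gens n (Idl\<^bsub>pring n\<^esub> (xset ` \<G>)) = (xset ` \<G> :: 'a::comm_ring_1 mpol set)"
  unfolding xset_image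
proof (rule min_gens_antichain)
  show "\<forall>a \<in> expo ` \<G>. Poly_Mapping.keys a \<subseteq> {1..n}" by (rule keys_gen)
next
  fix a b assume "a \<in> expo ` \<G>" "a + b \<in> expo ` \<G>"
  then obtain F G where FG: "F \<in> \<G>" "G \<in> \<G>" "a = expo F" "expo G = expo F + b" by auto
  then have "F \<subseteq> G" using expo_divides_iff[OF finite_gen finite_gen] by blast
  with antichain FG have "F = G" by blast
  then show "b = 0" using FG(4) by simp
qed

text \<open>
  The squarefree case of the two results on monomial ideals: the ideal generated by the
  monomials of an antichain \<open>\<G>\<close> of sets has as Stanley-Reisner complex the sets containing no
  member of \<open>\<G>\<close>, and as facet complex the sets contained in some member of \<open>\<G>\<close>. No algebra
  remains afterwards.
\<close>

lemma f_ideal_xsetI: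
  assumes antichain: "\<And>F G. F \<in> \<G> \<Longrightarrow> G \<in> \<G> \<Longrightarrow> F \<subseteq> G \<Longrightarrow> F = G"
    and deg: "\<And>F. F \<in> \<G> \<Longrightarrow> 2 \<le> card F"
    and f_vec: "f_vector {F. F \<subseteq> {1..n} \<and> \<not> (\<exists>G \<in> \<G>. G \<subseteq> F)} =
                f_vector {F. F \<subseteq> {1..n} \<and> (\<exists>G \<in> \<G>. F \<subseteq> G)}"
  shows "f_ideal n (Idl\<^bsub>pring n\<^esub> (xset ` \<G>) :: 'a::field mpol set)"
proof -
  let ?I = "Idl\<^bsub>pring n\<^esub> (xset ` \<G>) :: 'a mpol set"
  have min: "min_gens n ?I = xset ` \<G>"
    by (rule min_gens_xset[OF antichain])
  have "xset ` \<G> \<subseteq> (sqfree_monomials n :: 'a mpol set)"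
    using sub by (force simp: sqfree_monomials_def)
  then have "sqfree_monomial_ideal n ?I"
    unfolding sqfree_monomial_ideal_def by blast
  moreover have "2 \<le> mdeg a" if "mon a \<in> min_gens n ?I" for a
  proof -
    obtain F where F: "F \<in> \<G>" "mon a = (xset F :: 'a mpol)"
      using \<open>mon a \<in> min_gens n ?I\<close> unfolding min by blast
    then have "a = expo F" by (simp add: xset_eq_mon finite_gen)
    then show ?thesis using F deg by (simp add: mdeg_expo finite_gen)
  qed
  moreover have "stanley_reisner_complex n ?I = {F. F \<subseteq> {1..n} \<and> \<not> (\<exists>G \<in> \<G>. G \<subseteq> F)}"
    unfolding stanley_reisner_complex_def by (auto simp: xset_in_Idl_iff)
  moreover have "facet_complex n ?I = {F. F \<subseteq> {1..n} \<and> (\<exists>G \<in> \<G>. F \<subseteq> G)}"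
  proof -
    have "(\<exists>m \<in> xset ` \<G>. xset F divides\<^bsub>pring n :: 'a mpol ring\<^esub> m) \<longleftrightarrow> (\<exists>G \<in> \<G>. F \<subseteq> G)"
      if "F \<subseteq> {1..n}" for F
      unfolding bex_simps by (intro bex_cong refl xset_divides_iff that sub)
    then show ?thesis unfolding facet_complex_def min by blast
  qed
  ultimately show ?thesis
    using f_vec by (simp add: f_ideal_def)
qed

end

section \<open>Ideals generated in degrees two and three\<close>

text \<open>
  The dimension need not be compared separately: it is the largest cardinality that occurs, so
  the face counts determine it, and with it the length of the \<open>f\<close>-vector.
\<close>

lemma f_vector_cong:
  assumes fin: "finite \<Delta>" "finite \<Gamma>"
    and count: "\<And>d. card {F \<in> \<Delta>. card F = d} = card {F \<in> \<Gamma>. card F = d}"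
  shows "f_vector \<Delta> = f_vector \<Gamma>"
proof -
  have occurs: "d \<in> card ` S \<longleftrightarrow> card {F \<in> S. card F = d} \<noteq> 0" if "finite S" for S :: "nat set set" and d
    using that by auto
  have cards: "card ` \<Delta> = card ` \<Gamma>"
    by (rule Set.set_eqI) (simp only: occurs[OF fin(1)] occurs[OF fin(2)] count)
  have "(\<lambda>F. int (card F) - 1) ` S = (\<lambda>d. int d - 1) ` card ` S" for S :: "nat set set"
    by (simp add: image_image)
  then have "complex_dim \<Delta> = complex_dim \<Gamma>"
    by (simp add: complex_dim_def cards)
  moreover have "face_count \<Delta> = face_count \<Gamma>"
  proof
    fix i
    have "{F \<in> S. int (card F) = i + 1} = (if i + 1 < 0 then {} else {F \<in> S. card F = nat (i + 1)})"
      for S :: "nat set set"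
      by auto
    then show "face_count \<Delta> i = face_count \<Gamma> i"
      by (simp add: face_count_def count)
  qed
  moreover have "\<Delta> = {} \<longleftrightarrow> \<Gamma> = {}"
    using cards by blast
  ultimately show ?thesis by (simp add: f_vector_def)
qed

text \<open>
  The two complexes are compared one cardinality \<open>d\<close> at a time. For \<open>d \<le> 1\<close> both contain
  every set. For \<open>d = 2\<close> the first misses the members of \<open>E\<close>, the second the pairs that no
  generator covers. For \<open>d = 3\<close> the second consists of \<open>T\<close>, the first of the \<open>E\<close>-free triples
  outside \<open>T\<close>, so that equality means that \<open>T\<close> is exactly half of the \<open>E\<close>-free triples. For
  \<open>d \<ge> 4\<close> both are empty.
\<close>

lemma face_counts_eqI:
  fixes V :: "'a set" and E T :: "'a set set"
  defines "SR \<equiv> {F. F \<subseteq> V \<and> \<not> (\<exists>G \<in> E \<union> T. G \<subseteq> F)}"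
    and "FC \<equiv> {F. F \<subseteq> V \<and> (\<exists>G \<in> E \<union> T. F \<subseteq> G)}"
  assumes V: "finite V" "V \<noteq> {}"
    and E: "E \<subseteq> [V]\<^bsup>2\<^esup>" and T: "T \<subseteq> [V]\<^bsup>3\<^esup>"
    and no_edge: "\<And>e t. e \<in> E \<Longrightarrow> t \<in> T \<Longrightarrow> \<not> e \<subseteq> t"
    and vertices: "V \<subseteq> \<Union>(E \<union> T)"
    and pairs: "card {P \<in> [V]\<^bsup>2\<^esup>. P \<notin> E \<and> (\<forall>t \<in> T. \<not> P \<subseteq> t)} = card E"
    and triples: "card {F \<in> [V]\<^bsup>3\<^esup>. \<forall>e \<in> E. \<not> e \<subseteq> F} = 2 * card T"
    and quads: "\<And>Q. Q \<in> [V]\<^bsup>4\<^esup> \<Longrightarrow> \<exists>G \<in> E \<union> T. G \<subseteq> Q"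
  shows "card {F \<in> SR. card F = d} = card {F \<in> FC. card F = d}"
proof -
  have fin: "finite F" if "F \<subseteq> V" for F
    using that V(1) finite_subset by blast
  have cE: "card e = 2" "finite e" "e \<subseteq> V" if "e \<in> E" for e
    using that E by (auto simp: nsets_def)
  have cT: "card t = 3" "finite t" "t \<subseteq> V" if "t \<in> T" for t
    using that T by (auto simp: nsets_def)
  consider "d = 0" | "d = 1" | "d = 2" | "d = 3" | "d \<ge> 4" by linarith
  then show ?thesis
  proof cases
    case 1
    have "{F \<in> SR. card F = d} = {{}}"
      using 1 fin cE(1) cT(1) by (fastforce simp: SR_def)
    moreover have "{F \<in> FC. card F = d} = {{}}"
      using 1 fin V(2) vertices by (fastforce simp: FC_def)
    ultimately show ?thesis by simp
  next
    case 2
    have "\<not> G \<subseteq> {v}" if "G \<in> E \<union> T" for G v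
      using that cE(1) cT(1) card_mono[of "{v}" G] by force
    then have "{F \<in> SR. card F = d} = (\<lambda>v. {v}) ` V"
      using 2 by (auto simp: SR_def card_1_singleton_iff)
    moreover have "{F \<in> FC. card F = d} = (\<lambda>v. {v}) ` V"
      using 2 vertices by (fastforce simp: FC_def card_1_singleton_iff)
    ultimately show ?thesis by simp
  next
    case 3
    have small: "G = F" if "G \<in> E \<union> T" "G \<subseteq> F" "F \<subseteq> V" "card F = 2" for F G
      using that cE(1) cT(1) fin[OF that(3)] card_mono[of F G] card_subset_eq[of F G] by fastforce
    have "{F \<in> SR. card F = d} = [V]\<^bsup>2\<^esup> - E"
    proof (intro equalityI subsetI)
      fix F assume "F \<in> {F \<in> SR. card F = d}"
      then show "F \<in> [V]\<^bsup>2\<^esup> - E"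
        using 3 fin by (auto simp: SR_def nsets_def)
    next
      fix F assume "F \<in> [V]\<^bsup>2\<^esup> - E"
      then show "F \<in> {F \<in> SR. card F = d}"
        using 3 small[of _ F] cT(1) by (fastforce simp: SR_def nsets_def)
    qed
    moreover have "{F \<in> FC. card F = d} = [V]\<^bsup>2\<^esup> - {P \<in> [V]\<^bsup>2\<^esup>. P \<notin> E \<and> (\<forall>t \<in> T. \<not> P \<subseteq> t)}"
    proof (intro equalityI subsetI)
      fix F assume "F \<in> {F \<in> FC. card F = d}"
      then have F: "F \<subseteq> V" "card F = 2" "\<exists>G \<in> E \<union> T. F \<subseteq> G" "finite F"
        using 3 fin by (auto simp: FC_def)
      moreover have "F = e" if "e \<in> E" "F \<subseteq> e" for e
        using F(2) cE[OF that(1)] that(2) card_subset_eq by metis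
      ultimately show "F \<in> [V]\<^bsup>2\<^esup> - {P \<in> [V]\<^bsup>2\<^esup>. P \<notin> E \<and> (\<forall>t \<in> T. \<not> P \<subseteq> t)}"
        by (auto simp: nsets_def)
    qed (use 3 in \<open>auto simp: FC_def nsets_def\<close>)
    moreover have "card ([V]\<^bsup>2\<^esup> - U) = card ([V]\<^bsup>2\<^esup>) - card U" if "U \<subseteq> [V]\<^bsup>2\<^esup>" for U
      using that finite_imp_finite_nsets[OF V(1)] finite_subset by (intro card_Diff_subset) auto
    ultimately show ?thesis
      using E pairs by simp
  next
    case 4
    let ?free = "{F \<in> [V]\<^bsup>3\<^esup>. \<forall>e \<in> E. \<not> e \<subseteq> F}"
    have same: "t = F" if "t \<in> T" "t \<subseteq> F" "card F = 3" "finite F" for t F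
      using that cT(1) card_subset_eq by metis
    have "{F \<in> SR. card F = d} = ?free - T"
    proof (intro equalityI subsetI)
      fix F assume "F \<in> {F \<in> SR. card F = d}"
      then show "F \<in> ?free - T"
        using 4 fin by (auto simp: SR_def nsets_def)
    next
      fix F assume "F \<in> ?free - T"
      then show "F \<in> {F \<in> SR. card F = d}"
        using 4 same[of _ F] by (auto simp: SR_def nsets_def)
    qed
    moreover have "{F \<in> FC. card F = d} = T"
    proof (intro equalityI subsetI)
      fix F assume "F \<in> {F \<in> FC. card F = d}"
      then obtain G where G: "G \<in> E \<union> T" "F \<subseteq> G" "card F = 3"
        using 4 by (auto simp: FC_def)
      have "G \<notin> E"
        using G cE(1,2) card_mono[of G F] by force
      then have "G \<in> T" using G by blast
      then have "F = G" using G cT(1,2) card_subset_eq by metis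
      then show "F \<in> T" using \<open>G \<in> T\<close> by simp
    qed (use 4 cT in \<open>auto simp: FC_def\<close>)
    moreover have "T \<subseteq> ?free" using T no_edge by blast
    moreover have "finite T" using T finite_imp_finite_nsets[OF V(1)] finite_subset by blast
    ultimately show ?thesis using triples by (simp add: card_Diff_subset)
  next
    case 5
    have "{F \<in> SR. card F = d} = {}"
    proof (intro equals0I, unfold mem_Collect_eq)
      fix F assume F: "F \<in> SR \<and> card F = d"
      then obtain Q where "Q \<subseteq> F" "card Q = 4" "finite Q"
        using 5 obtain_subset_with_card_n[of 4 F] by auto
      then have "Q \<in> [V]\<^bsup>4\<^esup>" using F by (auto simp: SR_def nsets_def)
      from quads[OF this] obtain G where "G \<in> E \<union> T" "G \<subseteq> F" using \<open>Q \<subseteq> F\<close> by blast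
      then show False using F by (auto simp: SR_def)
    qed
    moreover have "{F \<in> FC. card F = d} = {}"
    proof (intro equals0I, unfold mem_Collect_eq)
      fix F assume "F \<in> FC \<and> card F = d"
      then obtain G where G: "G \<in> E \<union> T" "F \<subseteq> G" "card F \<ge> 4"
        using 5 by (auto simp: FC_def)
      then have "card G \<le> 3" "finite G" using cE cT by auto
      then show False using G card_mono[of G F] by linarith
    qed
    ultimately show ?thesis by (simp only: )
  qed
qed

lemma f_ideal_pairs_triplesI:
  fixes E T :: "nat set set"
  assumes "n \<noteq> 0"
    and E: "E \<subseteq> [{1..n}]\<^bsup>2\<^esup>" and T: "T \<subseteq> [{1..n}]\<^bsup>3\<^esup>"
    and no_edge: "\<And>e t. e \<in> E \<Longrightarrow> t \<in> T \<Longrightarrow> \<not> e \<subseteq> t"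
    and vertices: "{1..n} \<subseteq> \<Union>(E \<union> T)"
    and pairs: "card {P \<in> [{1..n}]\<^bsup>2\<^esup>. P \<notin> E \<and> (\<forall>t \<in> T. \<not> P \<subseteq> t)} = card E"
    and triples: "card {F \<in> [{1..n}]\<^bsup>3\<^esup>. \<forall>e \<in> E. \<not> e \<subseteq> F} = 2 * card T"
    and quads: "\<And>Q. Q \<in> [{1..n}]\<^bsup>4\<^esup> \<Longrightarrow> \<exists>G \<in> E \<union> T. G \<subseteq> Q"
  shows "f_ideal n (Idl\<^bsub>pring n\<^esub> (xset ` (E \<union> T)) :: 'a::field mpol set)"
proof (rule f_ideal_xsetI)
  have size: "finite G" "card G = 2 \<and> G \<in> E \<or> card G = 3 \<and> G \<in> T" if "G \<in> E \<union> T" for G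
    using that E T by (auto simp: nsets_def)
  show "F \<subseteq> {1..n}" if "F \<in> E \<union> T" for F
    using that E T by (auto simp: nsets_def)
  show "F = G" if FG: "F \<in> E \<union> T" "G \<in> E \<union> T" "F \<subseteq> G" for F G
  proof (rule card_subset_eq)
    show "card F = card G"
      using size(2)[OF FG(1)] size(2)[OF FG(2)] no_edge FG(3) card_mono[OF size(1)[OF FG(2)] FG(3)]
      by auto
  qed (use FG size in auto)
  show "2 \<le> card F" if "F \<in> E \<union> T" for F
    using size(2)[OF that] by auto
  show "f_vector {F. F \<subseteq> {1..n} \<and> \<not> (\<exists>G \<in> E \<union> T. G \<subseteq> F)} =
        f_vector {F. F \<subseteq> {1..n} \<and> (\<exists>G \<in> E \<union> T. F \<subseteq> G)}"
  proof (rule f_vector_cong)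
    show "card {F \<in> {F. F \<subseteq> {1..n} \<and> \<not> (\<exists>G \<in> E \<union> T. G \<subseteq> F)}. card F = d} =
          card {F \<in> {F. F \<subseteq> {1..n} \<and> (\<exists>G \<in> E \<union> T. F \<subseteq> G)}. card F = d}" for d
      by (rule face_counts_eqI) (use assms in auto)
  qed auto
qed

section \<open>Counting small subsets\<close>

lemma inj_on_insert_nsets: "a \<notin> A \<Longrightarrow> inj_on (insert a) ([A]\<^bsup>k\<^esup>)"
  by (rule inj_onI) (metis (no_types, lifting) insert_ident mem_Collect_eq nsets_def subset_iff)

lemma real_choose_two: "real (m choose 2) = real m * (real m - 1) / 2"
  by (induction m) (auto simp: numeral_2_eq_2 field_simps)

lemma real_choose_three: "real (m choose 3) = real m * (real m - 1) * (real m - 2) / 6"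
proof (induction m)
  case (Suc m)
  have "Suc m choose 3 = (m choose 2) + (m choose 3)"
    by (simp add: numeral_3_eq_3 numeral_2_eq_2)
  then show ?case using Suc real_choose_two[of m] by (simp add: field_simps)
qed simp

text \<open>
  A triple that contains no pair from \<open>E\<close> either lies in \<open>W\<close> or consists of one element of
  \<open>E\<close> and a pair from \<open>W\<close>.
\<close>

lemma card_triples_at_most_one:
  assumes fin: "finite E" "finite W" and disj: "E \<inter> W = {}"
  shows "card {F \<in> [E \<union> W]\<^bsup>3\<^esup>. \<forall>e \<in> [E]\<^bsup>2\<^esup>. \<not> e \<subseteq> F} =
         (card W choose 3) + card E * (card W choose 2)"
proof -
  let ?S = "{F \<in> [E \<union> W]\<^bsup>3\<^esup>. \<forall>e \<in> [E]\<^bsup>2\<^esup>. \<not> e \<subseteq> F}"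
  let ?f = "\<lambda>(e, P). insert e P"
  have only: "?S \<subseteq> [W]\<^bsup>3\<^esup> \<union> ?f ` (E \<times> [W]\<^bsup>2\<^esup>)"
  proof
    fix F assume F: "F \<in> ?S"
    show "F \<in> [W]\<^bsup>3\<^esup> \<union> ?f ` (E \<times> [W]\<^bsup>2\<^esup>)"
    proof (cases "F \<inter> E = {}")
      case True
      then show ?thesis using F by (auto simp: nsets_def)
    next
      case False
      then obtain e where e: "e \<in> F" "e \<in> E" by blast
      have "F - {e} \<subseteq> W"
      proof
        fix x assume x: "x \<in> F - {e}"
        have "{e, x} \<subseteq> F" using x e by simp
        moreover have "\<forall>e \<in> [E]\<^bsup>2\<^esup>. \<not> e \<subseteq> F" using F by simp
        ultimately have "{e, x} \<notin> [E]\<^bsup>2\<^esup>" by blast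
        then have "x \<notin> E" using x e(2) by auto
        then show "x \<in> W" using F x by (auto simp: nsets_def)
      qed
      then have "F - {e} \<in> [W]\<^bsup>2\<^esup>"
        using F e by (auto simp: nsets_def)
      moreover have "F = ?f (e, F - {e})" using e by auto
      ultimately show ?thesis using e by blast
    qed
  qed
  have no_pair: "\<not> e' \<subseteq> insert e P" if P: "P \<subseteq> W" and e': "e' \<in> [E]\<^bsup>2\<^esup>" for e e' P
  proof -
    obtain x y where "e' = {x, y}" "x \<in> E" "y \<in> E" "x \<noteq> y"
      using e' by (rule nsets2_E)
    then show ?thesis using P disj by blast
  qed
  have without: "[W]\<^bsup>3\<^esup> \<subseteq> ?S"
  proof
    fix F assume "F \<in> [W]\<^bsup>3\<^esup>"
    then have "F \<in> [E \<union> W]\<^bsup>3\<^esup>" "F \<subseteq> W" by (auto simp: nsets_def)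
    then show "F \<in> ?S" using no_pair by blast
  qed
  have with_one: "?f ` (E \<times> [W]\<^bsup>2\<^esup>) \<subseteq> ?S"
  proof clarify
    fix e P assume "e \<in> E" "P \<in> [W]\<^bsup>2\<^esup>"
    then have P: "P \<subseteq> W" "e \<notin> P" "finite P" "card P = 2" using disj by (auto simp: nsets_def)
    then have "insert e P \<in> [E \<union> W]\<^bsup>3\<^esup>" using \<open>e \<in> E\<close> by (auto simp: nsets_def)
    then show "insert e P \<in> [E \<union> W]\<^bsup>3\<^esup> \<and> (\<forall>e' \<in> [E]\<^bsup>2\<^esup>. \<not> e' \<subseteq> insert e P)"
      using no_pair[OF P(1)] by blast
  qed
  have S: "?S = [W]\<^bsup>3\<^esup> \<union> ?f ` (E \<times> [W]\<^bsup>2\<^esup>)"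
    by (intro equalityI Un_least only without with_one)
  have "inj_on ?f (E \<times> [W]\<^bsup>2\<^esup>)"
  proof (rule inj_onI, clarify)
    fix e P e' P' assume *: "e \<in> E" "e' \<in> E" "P \<in> [W]\<^bsup>2\<^esup>" "P' \<in> [W]\<^bsup>2\<^esup>" "insert e P = insert e' P'"
    then have "e \<notin> P \<union> P'" "e' \<notin> P \<union> P'" using disj by (auto simp: nsets_def)
    moreover from this have "e = e'" using *(5) by (metis UnI2 insertE insertI1)
    ultimately show "e = e' \<and> P = P'" using *(5) by (metis UnI1 UnI2 insert_ident)
  qed
  then have "card (?f ` (E \<times> [W]\<^bsup>2\<^esup>)) = card E * (card W choose 2)"
    by (simp add: card_image card_cartesian_product card_nsets fin)
  moreover have "[W]\<^bsup>3\<^esup> \<inter> ?f ` (E \<times> [W]\<^bsup>2\<^esup>) = {}"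
    using disj by (auto simp: nsets_def)
  ultimately show ?thesis
    unfolding S using fin by (simp add: card_Un_disjoint card_nsets finite_imp_finite_nsets)
qed

text \<open>
  The form in which the pigeonhole principle is used below: avoiding all \<open>m\<close>-subsets of the
  parts of a partition bounds the size of \<open>Q\<close>.
\<close>

lemma nsets_avoid_card_less:
  assumes "finite Q" "\<And>S. S \<in> [A]\<^bsup>m\<^esup> \<Longrightarrow> \<not> S \<subseteq> Q"
  shows "card (Q \<inter> A) < m"
proof (rule ccontr)
  assume "\<not> card (Q \<inter> A) < m"
  then obtain S where "S \<subseteq> Q \<inter> A" "card S = m" "finite S"
    using obtain_subset_with_card_n[of m "Q \<inter> A"] by (metis not_less)
  then show False using assms(2)[of S] by (auto simp: nsets_def)
qed

section \<open>The generators as pairs and triples of indices\<close>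

text \<open>
  Although even, the index \<open>2 * k\<close> is not in \<open>evens k\<close>: it is in no edge and no gap, and
  combines freely with pairs of odd indices instead. So the indices \<open>1, \<dots>, 2 * k\<close> split into
  \<open>evens k\<close> of size \<open>k - 1\<close>, \<open>odds k\<close> of size \<open>k\<close>, and \<open>2 * k\<close>.
\<close>

definition evens :: "nat \<Rightarrow> nat set" where
  "evens k = {i. even i \<and> 1 \<le> i \<and> i < 2 * k}"

definition odds :: "nat \<Rightarrow> nat set" where
  "odds k = {i. odd i \<and> i < 2 * k}"

text \<open>
  The index sets of the monomials in \<open>G1\<close>, \<open>NF\<close>, \<open>G2\<close>, \<open>G3\<close>, \<open>G4\<close> and \<open>G5\<close>, in this
  order.
\<close>

definition edges :: "nat \<Rightarrow> nat set set" where
  "edges k = [evens k]\<^bsup>2\<^esup>"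

definition gaps :: "nat \<Rightarrow> nat set set" where
  "gaps k = {{i, j} | i j. i \<in> odds k \<and> j \<in> evens k \<and> i + 1 < j}"

definition triples_pre_last :: "nat \<Rightarrow> nat set set" where
  "triples_pre_last k = insert (2 * k - 1) ` ([{1..<2 * k - 1}]\<^bsup>2\<^esup> - (gaps k \<union> edges k))"

definition triples_odd :: "nat \<Rightarrow> nat set set" where
  "triples_odd k = [odds k - {2 * k - 1}]\<^bsup>3\<^esup>"

definition triples_last :: "nat \<Rightarrow> nat set set" where
  "triples_last k = insert (2 * k) ` [odds k]\<^bsup>2\<^esup>"

definition triples_last_two :: "nat \<Rightarrow> nat set set" where
  "triples_last_two k = (\<lambda>i. {2 * k, 2 * k - 1, i}) ` evens k"

definition fixed_triples :: "nat \<Rightarrow> nat set set" where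
  "fixed_triples k = triples_pre_last k \<union> triples_odd k \<union> triples_last k \<union> triples_last_two k"

section \<open>Combinatorics of the generators\<close>

lemma finite_parity [simp]: "finite (evens k)" "finite (odds k)"
  unfolding evens_def odds_def by simp_all

lemma evens_odds_disjoint: "evens k \<inter> insert (2 * k) (odds k) = {}"
  by (auto simp: evens_def odds_def)

lemma vertices_eq: "k \<ge> 1 \<Longrightarrow> {1..2 * k} = evens k \<union> insert (2 * k) (odds k)"
  by (auto simp: evens_def odds_def intro: le_neq_implies_less elim: oddE)

lemma evens_image: "evens k = (\<lambda>a. 2 * a) ` {1..<k}"
  by (auto simp: evens_def elim!: evenE)

lemma odds_image: "odds k = (\<lambda>a. 2 * a + 1) ` {..<k}"
  by (auto simp: odds_def elim!: oddE)

lemma card_evens: "card (evens k) = k - 1"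
  unfolding evens_image by (subst card_image) (auto simp: inj_on_def)

lemma card_odds: "card (odds k) = k"
  unfolding odds_image by (subst card_image) (auto simp: inj_on_def)

text \<open>
  Lowering the smaller element by one turns the edge \<open>{2a, 2b}\<close>, where \<open>a < b\<close>, into the gap
  \<open>{2a - 1, 2b}\<close>. Both families are therefore indexed by the pairs \<open>a < b\<close> in \<open>{1..<k}\<close>.
\<close>

lemma card_gaps: "card (gaps k) = card (edges k)"
proof -
  define A where "A = {(a, b). 1 \<le> a \<and> a < b \<and> b < k}"
  have "edges k = (\<lambda>(a, b). {2 * a, 2 * b}) ` A"
  proof
    show "edges k \<subseteq> (\<lambda>(a, b). {2 * a, 2 * b}) ` A"
    proof
      fix e assume "e \<in> edges k"
      then obtain x y where xy: "x \<in> evens k" "y \<in> evens k" "x < y" "e = {x, y}"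
        unfolding edges_def ordered_nsets_2_eq by blast
      then obtain a b where "x = 2 * a" "y = 2 * b" "(a, b) \<in> A"
        by (auto simp: evens_image A_def)
      then show "e \<in> (\<lambda>(a, b). {2 * a, 2 * b}) ` A"
        using xy by force
    qed
    show "(\<lambda>(a, b). {2 * a, 2 * b}) ` A \<subseteq> edges k"
      by (auto simp: edges_def A_def evens_def)
  qed
  moreover have "gaps k = (\<lambda>(a, b). {2 * a - 1, 2 * b}) ` A"
  proof
    show "gaps k \<subseteq> (\<lambda>(a, b). {2 * a - 1, 2 * b}) ` A"
    proof
      fix e assume "e \<in> gaps k"
      then obtain i j where ij: "i \<in> odds k" "j \<in> evens k" "i + 1 < j" "e = {i, j}"
        by (auto simp: gaps_def)
      then obtain a b where ab: "i = 2 * a + 1" "j = 2 * b" "b < k"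
        by (auto simp: evens_image odds_image)
      then have "(a + 1, b) \<in> A" using ij by (auto simp: A_def)
      moreover have "e = (\<lambda>(a, b). {2 * a - 1, 2 * b}) (a + 1, b)"
        using ij ab by simp
      ultimately show "e \<in> (\<lambda>(a, b). {2 * a - 1, 2 * b}) ` A" by blast
    qed
    show "(\<lambda>(a, b). {2 * a - 1, 2 * b}) ` A \<subseteq> gaps k"
    proof clarify
      fix a b assume "(a, b) \<in> A"
      then have "2 * a - 1 \<in> odds k" "2 * b \<in> evens k" "2 * a - 1 + 1 < 2 * b"
        by (auto simp: A_def odds_def evens_def)
      then show "{2 * a - 1, 2 * b} \<in> gaps k" unfolding gaps_def by blast
    qed
  qed
  moreover have "inj_on (\<lambda>(a, b). {2 * a, 2 * b}) A"
    by (auto simp: inj_on_def A_def doubleton_eq_iff)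
  moreover have "inj_on (\<lambda>(a, b). {2 * a - 1, 2 * b}) A"
  proof (rule inj_onI, clarify)
    fix a b a' b' assume *: "(a, b) \<in> A" "(a', b') \<in> A" "{2 * a - 1, 2 * b} = {2 * a' - 1, 2 * b'}"
    have "2 * a - 1 \<noteq> 2 * b'" using *(1) by (simp add: A_def) presburger
    then have "2 * a - 1 = 2 * a' - 1" "2 * b = 2 * b'"
      using *(3) by (auto simp: doubleton_eq_iff)
    then show "a = a' \<and> b = b'" using * by (auto simp: A_def)
  qed
  ultimately show ?thesis by (simp add: card_image)
qed

text \<open>
  The triples containing \<open>2 * k - 1\<close> but not \<open>2 * k\<close> are built to cover, among the
  pairs below \<open>2 * k - 1\<close>, exactly those that are neither edges nor gaps.
  The pairs that involve \<open>2 * k - 1\<close> or \<open>2 * k\<close> are covered by the triples containing \<open>2 * k\<close>: those with two odd indices if the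
  other element of the pair is odd, and those with \<open>2 * k - 1\<close> if it is even. The set \<open>N\<close>
  stands for the triples that may be chosen freely.
\<close>

lemma uncovered_pairs_eq_gaps:
  assumes k: "k \<ge> 4"
    and new: "N \<subseteq> [{1..2 * k}]\<^bsup>3\<^esup>" "\<forall>F \<in> N. \<forall>g \<in> edges k \<union> gaps k. \<not> g \<subseteq> F"
  shows "{P \<in> [{1..2 * k}]\<^bsup>2\<^esup>. P \<notin> edges k \<and> (\<forall>t \<in> fixed_triples k \<union> N. \<not> P \<subseteq> t)} = gaps k"
    (is "?U = _")
proof (intro equalityI subsetI)
  fix P assume "P \<in> gaps k"
  then obtain i j where ij: "P = {i, j}" "i \<in> odds k" "j \<in> evens k" "i + 1 < j"
    by (auto simp: gaps_def)
  have par: "odd i" "even j" "j < 2 * k" "1 \<le> j" using ij by (auto simp: evens_def odds_def)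
  have i: "i < 2 * k - 3" using par ij(4) by presburger
  have j: "j < 2 * k - 1" using par by presburger
  have "P \<in> [{1..2 * k}]\<^bsup>2\<^esup>"
    using par ij i by (auto intro: Suc_leI odd_pos)
  moreover have "P \<notin> edges k"
    using par by (auto simp: ij(1) edges_def evens_def)
  moreover have "\<not> P \<subseteq> t" if "t \<in> triples_pre_last k" for t
  proof
    assume "P \<subseteq> t"
    from that obtain P' where P': "t = insert (2 * k - 1) P'" "P' \<in> [{1..<2 * k - 1}]\<^bsup>2\<^esup>" "P' \<notin> gaps k"
      by (auto simp: triples_pre_last_def)
    then have "P \<subseteq> P'" using \<open>P \<subseteq> t\<close> i j ij(1) by auto
    moreover have "card P = card P'" "finite P'"
      using P' ij(1,4) by (auto simp: nsets_def)
    ultimately have "P = P'" by (metis card_subset_eq)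
    then show False using \<open>P \<in> gaps k\<close> P' by simp
  qed
  moreover have "\<not> P \<subseteq> t" if "t \<in> triples_odd k \<union> triples_last k \<union> triples_last_two k" for t
    using that par i j
    by (auto simp: ij(1) triples_odd_def triples_last_def triples_last_two_def nsets_def odds_def evens_def)
  moreover have "\<not> P \<subseteq> t" if "t \<in> N" for t
    using that new(2) \<open>P \<in> gaps k\<close> by blast
  ultimately show "P \<in> ?U" by (auto simp: fixed_triples_def)
next
  fix P assume P: "P \<in> ?U"
  then have unc: "\<not> P \<subseteq> t" if "t \<in> fixed_triples k" for t using that by blast
  from P obtain x y where xy: "P = {x, y}" "1 \<le> x" "x < y" "y \<le> 2 * k"
    unfolding ordered_nsets_2_eq by auto
  show "P \<in> gaps k"
  proof (rule ccontr)
    assume no_gap: "P \<notin> gaps k"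
    consider "y = 2 * k" "odd x" | "y = 2 * k - 1" "odd x" | "y = 2 * k" "even x" |
      "y = 2 * k - 1" "even x" | "y < 2 * k - 1"
      using xy(4) by linarith
    then show False
    proof cases
      case 1
      then have x: "x \<in> odds k" using xy by (auto simp: odds_def)
      then obtain z where z: "z \<in> odds k" "z \<noteq> x"
      proof (cases "x = 1")
        case True
        with k that[of 3] show ?thesis by (simp add: odds_def)
      next
        case False
        with k that[of 1] show ?thesis by (simp add: odds_def)
      qed
      then have "insert (2 * k) {x, z} \<in> triples_last k"
        unfolding triples_last_def using x by (intro imageI) simp
      then have "insert (2 * k) {x, z} \<in> fixed_triples k" by (simp add: fixed_triples_def)
      then show False using unc 1 xy(1) by blast
    next
      case 2
      then have "{x, 2 * k - 1} \<in> [odds k]\<^bsup>2\<^esup>"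
        using xy k by (simp add: odds_def)
      then have "insert (2 * k) {x, 2 * k - 1} \<in> triples_last k"
        unfolding triples_last_def by (rule imageI)
      then have "insert (2 * k) {x, 2 * k - 1} \<in> fixed_triples k" by (simp add: fixed_triples_def)
      then show False using unc 2 xy(1) by blast
    next
      case 3
      then have "x \<in> evens k" using xy by (auto simp: evens_def)
      then have "{2 * k, 2 * k - 1, x} \<in> fixed_triples k"
        by (auto simp: fixed_triples_def triples_last_two_def)
      then show False using unc 3 xy(1) by blast
    next
      case 4
      then have "x \<in> evens k" using xy by (auto simp: evens_def)
      then have "{2 * k, 2 * k - 1, x} \<in> fixed_triples k"
        by (auto simp: fixed_triples_def triples_last_two_def)
      then show False using unc 4 xy(1) by blast
    next
      case 5
      then have "P \<in> [{1..<2 * k - 1}]\<^bsup>2\<^esup>" using xy by simp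
      then have "insert (2 * k - 1) P \<in> triples_pre_last k"
        unfolding triples_pre_last_def using P no_gap by (intro imageI) simp
      then have "insert (2 * k - 1) P \<in> fixed_triples k" by (simp add: fixed_triples_def)
      then show False using unc by blast
    qed
  qed
qed

lemma vertices_covered:
  assumes k: "k \<ge> 4"
  shows "{1..2 * k} \<subseteq> \<Union>(fixed_triples k)"
proof
  fix v assume v: "v \<in> {1..2 * k}"
  have "2 \<in> evens k" using k by (simp add: evens_def)
  then have last_two: "{2 * k, 2 * k - 1, 2} \<in> fixed_triples k"
    unfolding fixed_triples_def triples_last_two_def by blast
  consider "v = 2 * k" | "v = 2 * k - 1" | "v \<in> evens k" | "v \<in> odds k" "v \<noteq> 2 * k - 1"
  proof -
    have "k \<ge> 1" using k by simp
    from v have "v \<in> evens k \<union> insert (2 * k) (odds k)" unfolding vertices_eq[OF \<open>k \<ge> 1\<close>] .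
    then show ?thesis using that by blast
  qed
  then show "v \<in> \<Union>(fixed_triples k)"
  proof cases
    case 4
    then have "{v, 2 * k - 1} \<in> [odds k]\<^bsup>2\<^esup>"
      using k by (simp add: odds_def)
    then have "insert (2 * k) {v, 2 * k - 1} \<in> fixed_triples k"
      unfolding fixed_triples_def triples_last_def by blast
    then show ?thesis by blast
  next
    case 3
    then have "{2 * k, 2 * k - 1, v} \<in> fixed_triples k"
      by (auto simp: fixed_triples_def triples_last_two_def)
    then show ?thesis by blast
  qed (use last_two in blast)+
qed

text \<open>
  A set \<open>Q\<close> that contains no generator has at most one element in \<open>evens k\<close>. If it contains
  \<open>2 * k\<close>, it has at most one odd element. If not, it has at most two odd elements below
  \<open>2 * k - 1\<close>, and at most one if it contains \<open>2 * k - 1\<close>, because two odd indices never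
  form a gap. In every case \<open>Q\<close> has at most three elements.
\<close>

lemma quads_contain_generator:
  assumes k: "k \<ge> 1" and Q: "Q \<in> [{1..2 * k}]\<^bsup>4\<^esup>"
  shows "\<exists>G \<in> edges k \<union> fixed_triples k. G \<subseteq> Q"
proof (rule ccontr)
  assume "\<not> ?thesis"
  then have none: "\<not> G \<subseteq> Q" if "G \<in> edges k \<union> fixed_triples k" for G
    using that by blast
  let ?O = "odds k - {2 * k - 1}"
  have finQ: "finite Q" "card Q = 4" "Q \<subseteq> {1..2 * k}" using Q by (auto simp: nsets_def)
  have even_le: "card (Q \<inter> evens k) < 2"
    by (rule nsets_avoid_card_less[OF finQ(1)]) (use none in \<open>auto simp: edges_def\<close>)
  show False
  proof (cases "2 * k \<in> Q")
    case True
    have "card (Q \<inter> odds k) < 2"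
    proof (rule nsets_avoid_card_less[OF finQ(1)])
      show "\<not> S \<subseteq> Q" if "S \<in> [odds k]\<^bsup>2\<^esup>" for S
      proof -
        have "insert (2 * k) S \<in> fixed_triples k"
          using that by (simp add: fixed_triples_def triples_last_def)
        then show ?thesis using none True by blast
      qed
    qed
    moreover have "Q \<subseteq> insert (2 * k) ((Q \<inter> evens k) \<union> (Q \<inter> odds k))"
      using finQ(3) vertices_eq[OF k] by blast
    then have "card Q \<le> card (insert (2 * k) ((Q \<inter> evens k) \<union> (Q \<inter> odds k)))"
      using finQ(1) by (intro card_mono) auto
    moreover have "\<dots> \<le> Suc (card (Q \<inter> evens k) + card (Q \<inter> odds k))"
      using card_Un_le[of "Q \<inter> evens k" "Q \<inter> odds k"] finQ(1) by (simp add: card_insert_if)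
    ultimately show False using even_le finQ(2) by linarith
  next
    case no_last: False
    show False
    proof (cases "2 * k - 1 \<in> Q")
      case True
      have "card (Q \<inter> ?O) < 2"
      proof (rule nsets_avoid_card_less[OF finQ(1)])
        show "\<not> S \<subseteq> Q" if S: "S \<in> [?O]\<^bsup>2\<^esup>" for S
        proof -
          have "?O \<subseteq> {1..<2 * k - 1}"
          proof
            fix i assume "i \<in> ?O"
            then have "odd i" "i < 2 * k" "i \<noteq> 2 * k - 1" by (auto simp: odds_def)
            then show "i \<in> {1..<2 * k - 1}" by (auto simp: odd_pos Suc_le_eq)
          qed
          then have "S \<in> [{1..<2 * k - 1}]\<^bsup>2\<^esup>" using S nsets_mono by blast
          moreover have "S \<inter> evens k = {}" "S \<noteq> {}"
            using S by (auto simp: nsets_def odds_def evens_def)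
          then have "S \<notin> gaps k \<union> edges k"
            by (auto simp: gaps_def edges_def nsets_def)
          ultimately have "insert (2 * k - 1) S \<in> fixed_triples k"
            by (auto simp: fixed_triples_def triples_pre_last_def)
          then show ?thesis using none True by blast
        qed
      qed
      moreover have "Q \<subseteq> insert (2 * k - 1) ((Q \<inter> evens k) \<union> (Q \<inter> ?O))"
        using finQ(3) vertices_eq[OF k] no_last by blast
      then have "card Q \<le> card (insert (2 * k - 1) ((Q \<inter> evens k) \<union> (Q \<inter> ?O)))"
        using finQ(1) by (intro card_mono) auto
      moreover have "\<dots> \<le> Suc (card (Q \<inter> evens k) + card (Q \<inter> ?O))"
        using card_Un_le[of "Q \<inter> evens k" "Q \<inter> ?O"] finQ(1) by (simp add: card_insert_if)
      ultimately show False using even_le finQ(2) by linarith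
    next
      case False
      have "card (Q \<inter> ?O) < 3"
        by (rule nsets_avoid_card_less[OF finQ(1)])
          (use none in \<open>auto simp: fixed_triples_def triples_odd_def\<close>)
      moreover have "Q \<subseteq> (Q \<inter> evens k) \<union> (Q \<inter> ?O)"
        using finQ(3) vertices_eq[OF k] no_last False by blast
      then have "card Q \<le> card ((Q \<inter> evens k) \<union> (Q \<inter> ?O))"
        using finQ(1) by (intro card_mono) auto
      moreover have "\<dots> \<le> card (Q \<inter> evens k) + card (Q \<inter> ?O)"
        by (rule card_Un_le)
      ultimately show False using even_le finQ(2) by linarith
    qed
  qed
qed

lemma edges_not_in_fixed_triples:
  assumes e: "e \<in> edges k" and t: "t \<in> fixed_triples k"
  shows "\<not> e \<subseteq> t"
proof
  assume et: "e \<subseteq> t"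
  from e obtain x y where xy: "e = {x, y}" "x \<noteq> y" "x \<in> evens k" "y \<in> evens k"
    by (auto simp: edges_def elim: nsets2_E)
  have par: "even x" "even y" "x < 2 * k" "y < 2 * k" using xy by (auto simp: evens_def)
  have ne: "x \<noteq> 2 * k - 1" "y \<noteq> 2 * k - 1" using par by presburger+
  consider "t \<in> triples_pre_last k" | "t \<in> triples_odd k" | "t \<in> triples_last k" | "t \<in> triples_last_two k"
    using t by (auto simp: fixed_triples_def)
  then show False
  proof cases
    case 1
    then obtain P where P: "t = insert (2 * k - 1) P" "P \<in> [{1..<2 * k - 1}]\<^bsup>2\<^esup>" "P \<notin> edges k"
      by (auto simp: triples_pre_last_def)
    then have "e \<subseteq> P" using et ne xy(1) by auto
    moreover have "card e = card P" "finite P" using P xy by (auto simp: nsets_def)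
    ultimately have "e = P" by (metis card_subset_eq)
    then show False using e P by simp
  qed (use et par ne xy in \<open>auto simp: triples_odd_def triples_last_def triples_last_two_def nsets_def odds_def\<close>)
qed

lemma fixed_triples_subset:
  assumes k: "k \<ge> 1"
  shows "fixed_triples k \<subseteq> [{1..2 * k}]\<^bsup>3\<^esup>"
proof -
  have insert: "insert a P \<in> [B]\<^bsup>3\<^esup>" if "P \<in> [A]\<^bsup>2\<^esup>" "A \<subseteq> B" "a \<in> B" "a \<notin> A" for a P and A B :: "nat set"
    using that by (auto simp: nsets_def card_insert_if)
  have sub: "evens k \<subseteq> {1..2 * k}" "odds k \<subseteq> {1..2 * k}" "{1..<2 * k - 1} \<subseteq> {1..2 * k}"
    by (auto simp: evens_def odds_def odd_pos Suc_le_eq)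
  have "triples_pre_last k \<subseteq> [{1..2 * k}]\<^bsup>3\<^esup>"
    unfolding triples_pre_last_def by (intro image_subsetI insert[OF _ sub(3)]) (use k in auto)
  moreover have "triples_odd k \<subseteq> [{1..2 * k}]\<^bsup>3\<^esup>"
    unfolding triples_odd_def using sub(2) by (intro nsets_mono) blast
  moreover have "triples_last k \<subseteq> [{1..2 * k}]\<^bsup>3\<^esup>"
    unfolding triples_last_def
    by (intro image_subsetI insert[OF _ sub(2)]) (use k in \<open>auto simp: odds_def\<close>)
  moreover have "triples_last_two k \<subseteq> [{1..2 * k}]\<^bsup>3\<^esup>"
  proof -
    have "{2 * k, 2 * k - 1, i} \<in> [{1..2 * k}]\<^bsup>3\<^esup>" if "i \<in> evens k" for i
    proof -
      have "i \<noteq> 2 * k - 1" using that k unfolding evens_def by simp presburger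
      then have "card {2 * k, 2 * k - 1, i} = 3" using that k by (auto simp: evens_def)
      then show ?thesis using that k by (auto simp: nsets_def evens_def)
    qed
    then show ?thesis by (auto simp: triples_last_two_def)
  qed
  ultimately show ?thesis by (simp add: fixed_triples_def)
qed

section \<open>The number of triples\<close>

text \<open>
  The four summands are the sizes of the four families. The first one is
  \<open>(2k - 2 choose 2) - 2 (k - 1 choose 2)\<close>, since edges and gaps are equally many.
\<close>

lemma card_fixed_triples:
  assumes k: "k \<ge> 1"
  shows "real (card (fixed_triples k)) =
    (real k - 1) ^ 2 + (real k - 1) * (real k - 2) * (real k - 3) / 6 + real k * (real k - 1) / 2 + (real k - 1)"
proof -
  have card_O: "card (odds k - {2 * k - 1}) = k - 1"
    using k card_odds[of k] by (subst card_Diff_singleton) (auto simp: odds_def)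
  have rk: "real (k - 1) = real k - 1" using k by simp
  let ?B = "[{1..<2 * k - 1}]\<^bsup>2\<^esup>"
  have fin: "finite (triples_pre_last k)" "finite (triples_odd k)" "finite (triples_last k)" "finite (triples_last_two k)"
    by (simp_all add: triples_pre_last_def triples_odd_def triples_last_def triples_last_two_def
        finite_imp_finite_nsets)
  have bounds: "i < 2 * k - 1" if "i \<in> evens k" for i
    using that unfolding evens_def by simp presburger
  have pre_last: "real (card (triples_pre_last k)) = (real k - 1) ^ 2"
  proof -
    have sub: "gaps k \<union> edges k \<subseteq> ?B"
    proof -
      have "gaps k \<subseteq> ?B"
      proof
        fix P assume "P \<in> gaps k"
        then obtain i j where "P = {i, j}" "i \<in> odds k" "j \<in> evens k" "i + 1 < j"
          by (auto simp: gaps_def)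
        then show "P \<in> ?B"
          using bounds[of j] by (auto simp: odds_def evens_def odd_pos Suc_le_eq)
      qed
      moreover have "edges k \<subseteq> ?B"
        unfolding edges_def
      proof (rule nsets_mono)
        show "evens k \<subseteq> {1..<2 * k - 1}"
        proof
          fix i assume "i \<in> evens k"
          then show "i \<in> {1..<2 * k - 1}" using bounds[of i] by (simp add: evens_def)
        qed
      qed
      ultimately show ?thesis by simp
    qed
    have finB: "finite ?B" by (simp add: finite_imp_finite_nsets)
    have "gaps k \<inter> edges k = {}"
      by (auto simp: gaps_def edges_def nsets_def odds_def evens_def)
    then have "card (gaps k \<union> edges k) = 2 * (k - 1 choose 2)"
      using sub finB finite_subset[of _ ?B]
      by (simp add: card_Un_disjoint card_gaps) (simp add: edges_def card_nsets card_evens)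
    moreover have "card (?B - (gaps k \<union> edges k)) = card ?B - card (gaps k \<union> edges k)"
      using sub finB finite_subset by (intro card_Diff_subset) blast+
    moreover have "card (gaps k \<union> edges k) \<le> card ?B"
      using sub finB by (rule card_mono[rotated])
    moreover have "card ?B = (2 * k - 2) choose 2"
      by (simp add: card_nsets numeral_2_eq_2)
    moreover have "card (triples_pre_last k) = card (?B - (gaps k \<union> edges k))"
      unfolding triples_pre_last_def
      by (intro card_image inj_on_subset[OF inj_on_insert_nsets Diff_subset]) simp
    ultimately have "real (card (triples_pre_last k)) = real ((2 * k - 2) choose 2) - 2 * real (k - 1 choose 2)"
      by simp
    moreover have "real (2 * k - 2) = 2 * real k - 2" using k by simp
    ultimately show ?thesis
      by (simp add: real_choose_two rk field_simps power2_eq_square)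
  qed
  have odd: "real (card (triples_odd k)) = (real k - 1) * (real k - 2) * (real k - 3) / 6"
    unfolding triples_odd_def by (simp only: card_nsets card_O real_choose_three rk) simp
  have last: "real (card (triples_last k)) = real k * (real k - 1) / 2"
  proof -
    have "card (triples_last k) = card ([odds k]\<^bsup>2\<^esup>)"
      unfolding triples_last_def by (intro card_image inj_on_insert_nsets) (simp add: odds_def)
    then show ?thesis by (simp add: card_nsets card_odds real_choose_two)
  qed
  have last_two: "real (card (triples_last_two k)) = real k - 1"
  proof -
    have "inj_on (\<lambda>i. {2 * k, 2 * k - 1, i}) (evens k)"
    proof (rule inj_onI)
      fix i j assume *: "i \<in> evens k" "j \<in> evens k" "{2 * k, 2 * k - 1, i} = {2 * k, 2 * k - 1, j}"
      then have "i \<in> {2 * k, 2 * k - 1, j}" by blast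
      then show "i = j" using bounds[OF *(1)] by auto
    qed
    then show ?thesis using k by (simp add: triples_last_two_def card_image card_evens)
  qed
  have no_last: "2 * k \<notin> t" if "t \<in> triples_pre_last k \<union> triples_odd k" for t
    using that k by (auto simp: triples_pre_last_def triples_odd_def nsets_def odds_def)
  have has_last: "2 * k \<in> t" if "t \<in> triples_last k \<union> triples_last_two k" for t
    using that by (auto simp: triples_last_def triples_last_two_def)
  have "triples_pre_last k \<inter> triples_odd k = {}"
    by (auto simp: triples_pre_last_def triples_odd_def nsets_def)
  moreover have "triples_last k \<inter> triples_last_two k = {}"
  proof (rule equals0I)
    fix t assume "t \<in> triples_last k \<inter> triples_last_two k"
    then obtain P i where "t = insert (2 * k) P" "P \<subseteq> odds k" "i \<in> t" "i \<in> evens k"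
      by (auto simp: triples_last_def triples_last_two_def nsets_def)
    then show False using evens_odds_disjoint[of k] by blast
  qed
  moreover have "(triples_pre_last k \<union> triples_odd k) \<inter> (triples_last k \<union> triples_last_two k) = {}"
    using no_last has_last by blast
  ultimately have "card (fixed_triples k) =
      card (triples_pre_last k) + card (triples_odd k) + (card (triples_last k) + card (triples_last_two k))"
    unfolding fixed_triples_def Un_assoc[of "_ \<union> _"] using fin by (simp add: card_Un_disjoint)
  then show ?thesis using pre_last odd last last_two by simp
qed

text \<open>
  An edge-free triple has at most one element in \<open>evens k\<close>; the other \<open>k + 1\<close> indices are
  unrestricted.
\<close>

lemma real_card_triples_without_edge:
  assumes k: "k \<ge> 1"
  shows "real (card {F \<in> [{1..2 * k}]\<^bsup>3\<^esup>. \<forall>e \<in> edges k. \<not> e \<subseteq> F}) =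
    (real k + 1) * real k * (real k - 1) / 6 + (real k - 1) * ((real k + 1) * real k / 2)"
proof -
  have "card (insert (2 * k) (odds k)) = k + 1"
    by (simp add: card_odds card_insert_if) (simp add: odds_def)
  moreover have "real (k + 1) = real k + 1" "real (k - 1) = real k - 1" using k by simp_all
  ultimately show ?thesis
    unfolding vertices_eq[OF k] edges_def
    by (subst card_triples_at_most_one)
      (simp_all only: evens_odds_disjoint finite_parity finite_insert card_evens of_nat_add of_nat_mult
        real_choose_two real_choose_three, simp)
qed

section \<open>Translation to monomials, and the theorem\<close>

lemma X_mult_two: "i \<noteq> j \<Longrightarrow> X i * X j = (xset {i, j} :: 'a::comm_ring_1 mpol)"
  by (simp add: xset_def)

lemma X_mult_three:
  "i \<noteq> j \<Longrightarrow> i \<noteq> l \<Longrightarrow> j \<noteq> l \<Longrightarrow> X i * X j * X l = (xset {i, j, l} :: 'a::comm_ring_1 mpol)"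
  by (simp add: xset_def mult.assoc)

lemma G1_eq: "G1 k = (xset ` edges k :: 'a::field mpol set)"
proof (intro equalityI subsetI)
  fix m :: "'a mpol" assume "m \<in> G1 k"
  then obtain i j where ij: "1 \<le> i" "i < j" "j < k" "m = X (2 * i) * X (2 * j)"
    by (auto simp: G1_def)
  then have "{2 * i, 2 * j} \<in> edges k" by (simp add: edges_def evens_def)
  moreover have "m = xset {2 * i, 2 * j}" using ij by (simp add: X_mult_two)
  ultimately show "m \<in> xset ` edges k" by blast
next
  fix m :: "'a mpol" assume "m \<in> xset ` edges k"
  then obtain x y where xy: "x \<in> evens k" "y \<in> evens k" "x < y" "m = xset {x, y}"
    by (auto simp: edges_def ordered_nsets_2_eq)
  then obtain i j where "x = 2 * i" "y = 2 * j" "1 \<le> i" "i < j" "j < k"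
    by (auto simp: evens_image)
  moreover have "m = X x * X y" using xy by (simp add: X_mult_two)
  ultimately show "m \<in> G1 k" unfolding G1_def by blast
qed

lemma NF_eq: "NF k = (xset ` gaps k :: 'a::field mpol set)"
proof (intro equalityI subsetI)
  fix m :: "'a mpol" assume "m \<in> NF k"
  then obtain i j where ij: "1 \<le> i" "odd i" "even j" "i + 1 < j" "j < 2 * k" "m = X i * X j"
    by (auto simp: NF_def)
  then have "i \<in> odds k" "j \<in> evens k" by (auto simp: odds_def evens_def)
  then have "{i, j} \<in> gaps k" using ij(4) unfolding gaps_def by blast
  moreover have "m = xset {i, j}" using ij by (simp add: X_mult_two)
  ultimately show "m \<in> xset ` gaps k" by blast
next
  fix m :: "'a mpol" assume "m \<in> xset ` gaps k"
  then obtain i j where ij: "i \<in> odds k" "j \<in> evens k" "i + 1 < j" "m = xset {i, j}"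
    by (auto simp: gaps_def)
  then have "1 \<le> i" "odd i" "even j" "j < 2 * k" by (auto simp: odds_def evens_def odd_pos Suc_le_eq)
  moreover have "m = X i * X j" using ij by (simp add: X_mult_two)
  ultimately show "m \<in> NF k" using ij(3) unfolding NF_def by blast
qed

lemma finite_edges_gaps: "P \<in> gaps k \<union> edges k \<Longrightarrow> finite P"
  by (auto simp: gaps_def edges_def nsets_def)

lemma G2_eq: "G2 k = (xset ` triples_pre_last k :: 'a::field mpol set)"
proof -
  have in_iff: "(X i * X j :: 'a mpol) \<in> NF k \<union> G1 k \<longleftrightarrow> {i, j} \<in> gaps k \<union> edges k"
    if "i < j" for i j
  proof -
    have "(X i * X j :: 'a mpol) \<in> NF k \<union> G1 k \<longleftrightarrow> xset {i, j} \<in> (xset ` (gaps k \<union> edges k) :: 'a mpol set)"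
      using that by (simp add: X_mult_two NF_eq G1_eq image_Un)
    also have "\<dots> \<longleftrightarrow> {i, j} \<in> gaps k \<union> edges k"
    proof
      assume "xset {i, j} \<in> (xset ` (gaps k \<union> edges k) :: 'a mpol set)"
      then obtain P where P: "(xset {i, j} :: 'a mpol) = xset P" "P \<in> gaps k \<union> edges k" by blast
      then have "{i, j} = P"
        using xset_eq_iff[where 'a = 'a, of "{i, j}" P] finite_edges_gaps[OF P(2)] by simp
      then show "{i, j} \<in> gaps k \<union> edges k" using P(2) by simp
    qed blast
    finally show ?thesis .
  qed
  show ?thesis
  proof (intro equalityI subsetI)
    fix m :: "'a mpol" assume "m \<in> G2 k"
    then obtain i j where ij: "1 \<le> i" "i < j" "j < 2 * k - 1" "(X i * X j :: 'a mpol) \<notin> NF k \<union> G1 k"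
      "m = X i * X j * X (2 * k - 1)"
      unfolding G2_def by blast
    then have "{i, j} \<in> [{1..<2 * k - 1}]\<^bsup>2\<^esup> - (gaps k \<union> edges k)"
      using in_iff[OF ij(2)] by simp
    then have "insert (2 * k - 1) {i, j} \<in> triples_pre_last k"
      unfolding triples_pre_last_def by (rule imageI)
    moreover have "m = xset {i, j, 2 * k - 1}"
      unfolding ij(5) by (rule X_mult_three) (use ij in auto)
    moreover have "{i, j, 2 * k - 1} = insert (2 * k - 1) {i, j}" by blast
    ultimately show "m \<in> xset ` triples_pre_last k" by (metis imageI)
  next
    fix m :: "'a mpol" assume "m \<in> xset ` triples_pre_last k"
    then obtain P where P: "m = xset (insert (2 * k - 1) P)" "P \<in> [{1..<2 * k - 1}]\<^bsup>2\<^esup>"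
      "P \<notin> gaps k \<union> edges k"
      by (auto simp: triples_pre_last_def)
    then obtain i j where ij: "P = {i, j}" "1 \<le> i" "i < j" "j < 2 * k - 1"
      unfolding ordered_nsets_2_eq by auto
    have "insert (2 * k - 1) P = {i, j, 2 * k - 1}" using ij(1) by blast
    then have "m = xset {i, j, 2 * k - 1}" by (simp only: P(1))
    also have "\<dots> = X i * X j * X (2 * k - 1)"
      by (rule X_mult_three[symmetric]) (use ij in auto)
    finally show "m \<in> G2 k"
      using P(3) ij in_iff[OF ij(3)] unfolding G2_def by blast
  qed
qed

lemma G3_eq: "G3 k = (xset ` triples_odd k :: 'a::field mpol set)"
proof (intro equalityI subsetI)
  fix m :: "'a mpol" assume "m \<in> G3 k"
  then obtain i j l where *: "1 \<le> i" "i < j" "j < l" "l < 2 * k - 1" "odd i" "odd j" "odd l" "m = X i * X j * X l"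
    unfolding G3_def by blast
  then have "{i, j, l} \<in> triples_odd k"
    by (auto simp: triples_odd_def nsets_def odds_def)
  moreover have "m = xset {i, j, l}" using * by (simp add: X_mult_three)
  ultimately show "m \<in> xset ` triples_odd k" by blast
next
  fix m :: "'a mpol" assume "m \<in> xset ` triples_odd k"
  then obtain i j l where *: "i \<in> odds k - {2 * k - 1}" "j \<in> odds k - {2 * k - 1}" "l \<in> odds k - {2 * k - 1}"
    "i < j" "j < l" "m = xset {i, j, l}"
    unfolding triples_odd_def ordered_nsets_3_eq by blast
  then have "1 \<le> i" "l < 2 * k - 1" "odd i" "odd j" "odd l"
    by (auto simp: odds_def odd_pos Suc_le_eq)
  moreover have "m = X i * X j * X l" using * by (simp add: X_mult_three)
  ultimately show "m \<in> G3 k" using *(4,5) unfolding G3_def by blast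
qed

lemma G4_eq: "G4 k = (xset ` triples_last k :: 'a::field mpol set)"
proof (intro equalityI subsetI)
  fix m :: "'a mpol" assume "m \<in> G4 k"
  then obtain i j where *: "1 \<le> i" "i < j" "j \<le> 2 * k - 1" "odd i" "odd j" "m = X (2 * k) * X i * X j"
    unfolding G4_def by blast
  then have "insert (2 * k) {i, j} \<in> triples_last k"
    unfolding triples_last_def by (intro imageI) (auto simp: odds_def)
  moreover have "m = xset {2 * k, i, j}"
    unfolding *(6) by (rule X_mult_three) (use * in auto)
  ultimately show "m \<in> xset ` triples_last k" by blast
next
  fix m :: "'a mpol" assume "m \<in> xset ` triples_last k"
  then obtain i j where *: "i \<in> odds k" "j \<in> odds k" "i < j" "m = xset {2 * k, i, j}"
    unfolding triples_last_def ordered_nsets_2_eq by blast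
  then have "1 \<le> i" "j \<le> 2 * k - 1" "odd i" "odd j"
    by (auto simp: odds_def odd_pos Suc_le_eq)
  moreover from this have "m = X (2 * k) * X i * X j"
    unfolding *(4) by (intro X_mult_three[symmetric]) (use * in auto)
  ultimately show "m \<in> G4 k" using *(3) unfolding G4_def by blast
qed

lemma G5_eq: "G5 k = (xset ` triples_last_two k :: 'a::field mpol set)"
proof -
  have i_iff: "even i \<and> 2 \<le> i \<and> i \<le> 2 * k - 2 \<longleftrightarrow> i \<in> evens k" for i
    unfolding evens_def mem_Collect_eq by presburger
  have mult: "X (2 * k) * X (2 * k - 1) * X i = (xset {2 * k, 2 * k - 1, i} :: 'a mpol)"
    if "i \<in> evens k" for i
  proof (rule X_mult_three)
    show "2 * k \<noteq> 2 * k - 1" "2 * k \<noteq> i" "2 * k - 1 \<noteq> i"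
      using that unfolding evens_def mem_Collect_eq by presburger+
  qed
  have "G5 k = (\<lambda>i. X (2 * k) * X (2 * k - 1) * X i :: 'a mpol) ` evens k"
    unfolding G5_def i_iff by blast
  also have "\<dots> = (\<lambda>i. xset {2 * k, 2 * k - 1, i}) ` evens k"
    by (intro image_cong refl mult)
  finally show ?thesis by (simp only: triples_last_two_def image_image)
qed

lemma G2_to_G5_eq: "G2 k \<union> G3 k \<union> G4 k \<union> G5 k = (xset ` fixed_triples k :: 'a::field mpol set)"
  by (simp add: fixed_triples_def image_Un G2_eq G3_eq G4_eq G5_eq)

theorem theorem4p7:
  fixes k n :: nat and G6 :: "'a::field mpol set"
  assumes "n = 2 * k" and "k \<ge> 4"
    and "G6 \<subseteq> sqfree_monomials_deg n 3"
    and "real (card G6) = (real k ^ 3 - 3 * real k ^ 2 - 4 * real k + 6) / 6"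
    and "G6 \<inter> (G2 k \<union> G3 k \<union> G4 k \<union> G5 k) = {}"
    and "\<forall>m \<in> G6. \<forall>g \<in> G1 k \<union> NF k. \<not> g divides\<^bsub>pring n\<^esub> m"
  shows "f_ideal n (Idl\<^bsub>pring n\<^esub> (G1 k \<union> G2 k \<union> G3 k \<union> G4 k \<union> G5 k \<union> G6))"
proof -
  note n = assms(1)
  have k: "k \<ge> 1" using assms(2) by simp
  define N where "N = {F \<in> [{1..2 * k}]\<^bsup>3\<^esup>. (xset F :: 'a mpol) \<in> G6}"
  let ?E = "edges k" and ?T = "fixed_triples k \<union> N"
  have N_sub: "N \<subseteq> [{1..2 * k}]\<^bsup>3\<^esup>" by (auto simp: N_def)
  have fixed_sub: "fixed_triples k \<subseteq> [{1..2 * k}]\<^bsup>3\<^esup>" by (rule fixed_triples_subset[OF k])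
  have fin3: "finite ([{1..2 * k}]\<^bsup>3\<^esup>)" by (simp add: finite_imp_finite_nsets)
  have G6_eq: "G6 = xset ` N"
  proof (intro equalityI subsetI)
    fix m assume "m \<in> G6"
    then obtain F where "m = xset F" "F \<subseteq> {1..2 * k}" "card F = 3"
      using assms(3) n by (auto simp: sqfree_monomials_deg_def)
    then show "m \<in> xset ` N"
      using \<open>m \<in> G6\<close> finite_subset by (fastforce simp: N_def nsets_def)
  qed (auto simp: N_def)
  have inj: "inj_on (xset :: nat set \<Rightarrow> 'a mpol) N"
    by (auto simp: inj_on_def N_def nsets_def xset_eq_iff)
  have card_N: "real (card N) = (real k ^ 3 - 3 * real k ^ 2 - 4 * real k + 6) / 6"
    using assms(4) card_image[OF inj] by (simp add: G6_eq)
  have N_disj: "fixed_triples k \<inter> N = {}"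
    using assms(5) unfolding G2_to_G5_eq G6_eq by blast
  have edges_sub: "?E \<subseteq> [{1..2 * k}]\<^bsup>2\<^esup>"
    unfolding edges_def by (rule nsets_mono) (auto simp: evens_def)
  have gaps_sub: "g \<subseteq> {1..2 * k}" if "g \<in> edges k \<union> gaps k" for g
    using that by (auto simp: edges_def gaps_def nsets_def evens_def odds_def odd_pos Suc_le_eq)
  have N_free: "\<forall>F \<in> N. \<forall>g \<in> edges k \<union> gaps k. \<not> g \<subseteq> F"
  proof (intro ballI notI)
    fix F g assume F: "F \<in> N" and g: "g \<in> edges k \<union> gaps k" and "g \<subseteq> F"
    have "F \<subseteq> {1..n}" using F by (simp add: N_def nsets_def n)
    then have "(xset g :: 'a mpol) divides\<^bsub>pring n\<^esub> xset F"
      using \<open>g \<subseteq> F\<close> by (subst xset_divides_iff) auto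
    moreover have "(xset F :: 'a mpol) \<in> G6" using F by (simp add: N_def)
    moreover have "(xset g :: 'a mpol) \<in> G1 k \<union> NF k"
      using g by (auto simp: G1_eq NF_eq)
    ultimately show False using assms(6) by blast
  qed
  have "f_ideal (2 * k) (Idl\<^bsub>pring (2 * k)\<^esub> (xset ` (?E \<union> ?T)) :: 'a mpol set)"
  proof (rule f_ideal_pairs_triplesI)
    show "?T \<subseteq> [{1..2 * k}]\<^bsup>3\<^esup>" using N_sub fixed_sub by simp
    show "\<not> e \<subseteq> t" if "e \<in> ?E" "t \<in> ?T" for e t
      using that edges_not_in_fixed_triples N_free by blast
    show "{1..2 * k} \<subseteq> \<Union>(?E \<union> ?T)"
      using vertices_covered[OF assms(2)] by auto
    \<comment> \<open>The free triples contain no gap, so the gaps stay uncovered.\<close>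
    show "card {P \<in> [{1..2 * k}]\<^bsup>2\<^esup>. P \<notin> ?E \<and> (\<forall>t \<in> ?T. \<not> P \<subseteq> t)} = card ?E"
      by (simp only: uncovered_pairs_eq_gaps[OF assms(2) N_sub N_free] card_gaps)
    show "card {F \<in> [{1..2 * k}]\<^bsup>3\<^esup>. \<forall>e \<in> ?E. \<not> e \<subseteq> F} = 2 * card ?T"
    proof -
      have "finite N" "finite (fixed_triples k)"
        using N_sub fixed_sub fin3 finite_subset by auto
      then have "real (card ?T) = real (card (fixed_triples k)) + real (card N)"
        using N_disj by (simp add: card_Un_disjoint)
      \<comment> \<open>The size prescribed for \<open>G6\<close> makes both sides the same cubic polynomial in \<open>k\<close>.\<close>
      then have "real (card {F \<in> [{1..2 * k}]\<^bsup>3\<^esup>. \<forall>e \<in> ?E. \<not> e \<subseteq> F}) = real (2 * card ?T)"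
        unfolding real_card_triples_without_edge[OF k] of_nat_mult
        by (simp add: card_fixed_triples[OF k] card_N field_simps power2_eq_square power3_eq_cube)
      then show ?thesis by (simp only: of_nat_eq_iff)
    qed
    show "\<exists>G \<in> ?E \<union> ?T. G \<subseteq> Q" if "Q \<in> [{1..2 * k}]\<^bsup>4\<^esup>" for Q
      using quads_contain_generator[OF k that] by blast
  qed (use k edges_sub in auto)
  moreover have "G1 k \<union> G2 k \<union> G3 k \<union> G4 k \<union> G5 k \<union> G6 = xset ` (?E \<union> ?T)"
    using G2_to_G5_eq[of k, where 'a = 'a] by (simp add: image_Un G1_eq G6_eq Un_assoc)
  ultimately show ?thesis unfolding n by simp
qed

end
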